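(* Let $l=k=1$, i.e. $\mathcal{Y}\subseteq\mathbb{R}$ and $\Theta\subseteq\mathbb{R}$. Consider a class $\mathcal{P}$ of true densities and assume: (i) $\mathcal{Y}$ and $\Theta$ are open and convex, $\vartheta_{t|t-1}\in\Theta$ and $\vartheta_{t|t}(y_t)\in\Theta$ (for the updating rules considered); (ii) $\log f(x|\vartheta)$ is twice continuously differentiable in $\vartheta$ and Lipschitz continuous in $x$, for all $\vartheta\in\Theta$ and $x\in\mathcal{Y}$; (iii) for all $p_t\in\mathcal{P}$, $p_t(x)$ is Lipschitz continuous in $x$ and bounded for all $x\in\mathcal{Y}$. Then, for any $y_t\in\mathcal{Y}$, $\vartheta_{t|t-1}\in\Theta$ and $p_t\in\mathcal{P}$ with $\big(p_t(y_t)-f(y_t|\vartheta_{t|t-1})\big)\,s(y_t,\vartheta_{t|t-1})\neq0$, there exist a $\bar\kappa>0$ and a $\delta\equiv\delta_{\bar\kappa}>0$ such that for all updating rules $\phi$ with $\Delta\phi(y_t,\vartheta_{t|t-1})\neq0$ and $|\Delta\phi(y_t,\vartheta_{t|t-1})|<\bar\kappa$, we have $$\Delta^{\mathsf{CKL}}_\delta(\phi|y_t,\vartheta_{t|t-1},p_t)<0\quad\Longleftrightarrow\quad s(y_t,\vartheta_{t|t-1})\,\Delta\phi(y_t,\vartheta_{t|t-1})\,\big(p_t(y_t)-f(y_t|\vartheta_{t|t-1})\big)>0.$$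
   Context: $p_t$ is the true density (on $\mathcal{Y}$) of the observation with realization $y_t$; $f(\cdot|\vartheta)$, $\vartheta\in\Theta$, is a postulated (possibly misspecified) family of densities on $\mathcal{Y}$, whose support contains the support of $p_t$. The score is $s(y,\vartheta)=\frac{\partial}{\partial\vartheta}\log f(y|\vartheta)$. An updating rule is a map $\phi:\mathcal{Y}\times\Theta\to\Theta$; the updated parameter is $\vartheta_{t|t}=\vartheta_{t|t}(y_t)=\phi(y_t,\vartheta_{t|t-1})$ and $\Delta\phi(y_t,\vartheta_{t|t-1}):=\vartheta_{t|t}-\vartheta_{t|t-1}$. Censored KL. For $\delta>0$ let $B=B_\delta(y_t)=\{x\in\mathcal{Y}:|x-y_t|\le\delta\}$ and $B^c=\mathcal{Y}\setminus B$. For a parameter value $\vartheta$ set $$\mathsf{CKL}_B(p_t\Vert f(\cdot|\vartheta)):=\int_B\log\Big(\frac{p_t(x)}{f(x|\vartheta)}\Big)p_t(x)\,dx+\log\Big(\frac{\int_{B^c}p_t(x)\,dx}{\int_{B^c}f(x|\vartheta)\,dx}\Big)\int_{B^c}p_t(x)\,dx,$$ and $$\Delta^{\mathsf{CKL}}_\delta(\phi|y_t,\vartheta_{t|t-1},p_t):=\mathsf{CKL}_{B_\delta(y_t)}(p_t\Vert f(\cdot|\vartheta_{t|t}))-\mathsf{CKL}_{B_\delta(y_t)}(p_t\Vert f(\cdot|\vartheta_{t|t-1})).$$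
   Formalization: Assumption (ii) is strengthened: the second derivative of log f(x|ϑ) in ϑ is assumed continuous jointly in (x,ϑ), not merely in ϑ for each x; with only the latter the score may jump in x and the claim fails. *)

theory Defs
  imports "HOL-Analysis.Analysis"
begin

definition density_on :: "real set \<Rightarrow> (real \<Rightarrow> real) \<Rightarrow> bool" where
  "density_on Y p \<longleftrightarrow>
     (\<forall>x\<in>Y. 0 \<le> p x) \<and> set_integrable lborel Y p \<and> (LBINT x:Y. p x) = 1"

text \<open>
  The density \<open>f(x|\<theta>)\<close> is written \<open>f x \<theta>\<close>. Since \<open>log f(x|\<theta>)\<close> has to be a real number for all
  \<open>x \<in> Y\<close> and \<open>\<theta> \<in> \<Theta>\<close>, whereas \<open>ln 0 = 0\<close> in HOL, positivity is stated explicitly. It entails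
  that the support of \<open>f(\<cdot>|\<theta>)\<close> contains the support of every density on \<open>Y\<close>.
\<close>

definition density_family :: "real set \<Rightarrow> real set \<Rightarrow> (real \<Rightarrow> real \<Rightarrow> real) \<Rightarrow> bool" where
  "density_family Y \<Theta> f \<longleftrightarrow>
     (\<forall>\<theta>\<in>\<Theta>. density_on Y (\<lambda>x. f x \<theta>) \<and> (\<forall>x\<in>Y. 0 < f x \<theta>))"

text \<open>
  The second partial derivative with respect to the parameter is continuous as a function on
  \<open>Y \<times> \<Theta>\<close>. Continuity in \<open>\<theta>\<close> for each fixed \<open>x\<close> would not do: it allows the score to jump in
  \<open>x\<close>, even if \<open>g\<close> is Lipschitz in \<open>x\<close>. Joint continuity of the first derivative is not required
  separately, as it follows if \<open>g\<close> is also continuous in \<open>x\<close>.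
\<close>

definition C2_in_parameter :: "real set \<Rightarrow> real set \<Rightarrow> (real \<Rightarrow> real \<Rightarrow> real) \<Rightarrow> bool" where
  "C2_in_parameter Y \<Theta> g \<longleftrightarrow>
     (\<forall>x\<in>Y. \<forall>\<theta>\<in>\<Theta>. g x differentiable (at \<theta>) \<and> deriv (g x) differentiable (at \<theta>)) \<and>
     continuous_on (Y \<times> \<Theta>) (\<lambda>(x, \<theta>). deriv (deriv (g x)) \<theta>)"

definition score :: "(real \<Rightarrow> real \<Rightarrow> real) \<Rightarrow> real \<Rightarrow> real \<Rightarrow> real" where
  "score f y \<theta> = deriv (\<lambda>\<theta>'. ln (f y \<theta>')) \<theta>"

definition update_step :: "(real \<times> real \<Rightarrow> real) \<Rightarrow> real \<Rightarrow> real \<Rightarrow> real" where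
  "update_step \<phi> y \<theta> = \<phi> (y, \<theta>) - \<theta>"

definition obs_ball :: "real set \<Rightarrow> real \<Rightarrow> real \<Rightarrow> real set" where
  "obs_ball Y \<delta> y = {x \<in> Y. \<bar>x - y\<bar> \<le> \<delta>}"

text \<open>
  The HOL conventions \<open>ln 0 = 0\<close> and \<open>a / 0 = 0\<close> agree with the usual \<open>0 log 0 = 0\<close>, because both
  logarithms are multiplied by their numerators.
\<close>

definition CKL :: "real set \<Rightarrow> real set \<Rightarrow> (real \<Rightarrow> real) \<Rightarrow> (real \<Rightarrow> real) \<Rightarrow> real" where
  "CKL Y B p g =
     (LBINT x:B. ln (p x / g x) * p x) +
     ln ((LBINT x:Y - B. p x) / (LBINT x:Y - B. g x)) * (LBINT x:Y - B. p x)"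

definition CKL_change ::
  "real set \<Rightarrow> (real \<Rightarrow> real \<Rightarrow> real) \<Rightarrow> real \<Rightarrow> (real \<times> real \<Rightarrow> real) \<Rightarrow> real \<Rightarrow> real
     \<Rightarrow> (real \<Rightarrow> real) \<Rightarrow> real" where
  "CKL_change Y f \<delta> \<phi> y \<theta> p =
     CKL Y (obs_ball Y \<delta> y) p (\<lambda>x. f x (\<phi> (y, \<theta>))) - CKL Y (obs_ball Y \<delta> y) p (\<lambda>x. f x \<theta>)"

end

theory Submission
  imports Defs "HOL-Real_Asymp.Real_Asymp"
begin

text \<open>
  Write \<open>B = [y - \<delta>, y + \<delta>]\<close>, and let \<open>P\<close> be the mass that \<open>p\<close> puts outside \<open>B\<close>. Up to a term
  that depends on \<open>p\<close> alone, the censored divergence is minus the censored log score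
  \<open>\<integral>\<^sub>B p ln f + P ln (1 - \<integral>\<^sub>B f)\<close>, so the question is whether this score increases when the parameter
  moves from \<open>\<theta>\<close> to \<open>\<theta>'\<close>. The mean value theorem, applied to the outer logarithm, turns the increase
  into a single integral over \<open>B\<close>,
  \<open>\<integral>\<^sub>B (p (ln f' - ln f) - c (f' - f))\<close> where \<open>c = P / \<eta>\<close>,
  in which \<open>\<eta>\<close> lies between the two masses that the model puts outside \<open>B\<close>
  (lemma \<open>censored_log_score_diff\<close>). As \<open>B\<close> shrinks, \<open>P\<close> and \<open>\<eta>\<close> tend to \<open>1\<close>, and so does \<open>c\<close>.

  For a fixed \<open>x\<close>, a second use of the mean value theorem, now in the parameter, writes the integrand
  as \<open>(\<theta>' - \<theta>) * s(x, \<xi>) * (p x - c * f(x, \<xi>))\<close>. When the last two factors are jointly continuous at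
  \<open>(y, \<theta>)\<close>, their product is close to \<open>s(y, \<theta>) (p y - f(y, \<theta>))\<close>, which is nonzero, as soon as \<open>\<delta>\<close> and
  the step are small. The integrand then has one sign on all of \<open>B\<close>, that of the step
  times \<open>s(y, \<theta>) (p y - f(y, \<theta>))\<close>.

  The joint continuity of the score and of \<open>ln f\<close> (lemma \<open>C2_in_parameter_tendsto_jointly\<close>) is where
  smoothness enters. The second derivative is bounded near \<open>(y, \<theta>)\<close>, so difference quotients of \<open>ln f\<close>
  in the parameter approximate the score uniformly in \<open>x\<close>; those quotients are continuous in \<open>x\<close>.
\<close>

section \<open>Joint continuity in observation and parameter\<close>

lemma box_of_eventually_nhds:
  fixes y \<theta> :: real
  assumes "eventually Q (nhds (y, \<theta>))"
  obtains r where "r > 0" "\<And>x t. \<bar>x - y\<bar> < r \<Longrightarrow> \<bar>t - \<theta>\<bar> < r \<Longrightarrow> Q (x, t)"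
proof -
  from assms obtain S T where S: "eventually S (nhds y)" and T: "eventually T (nhds \<theta>)"
    and Q: "\<And>x t. S x \<Longrightarrow> T t \<Longrightarrow> Q (x, t)"
    unfolding nhds_prod eventually_prod_filter by auto
  from S obtain d where "d > 0" "\<And>x. \<bar>x - y\<bar> < d \<Longrightarrow> S x"
    by (auto simp: eventually_nhds_metric dist_real_def)
  moreover from T obtain e where "e > 0" "\<And>t. \<bar>t - \<theta>\<bar> < e \<Longrightarrow> T t"
    by (auto simp: eventually_nhds_metric dist_real_def)
  ultimately show thesis
    using Q by (intro that[of "min d e"]) auto
qed

text \<open>
  The endpoints come in either order, because the sign of an update step is unknown.
\<close>
lemma mean_value_segment:
  fixes h h' :: "real \<Rightarrow> real"
  assumes "\<And>t. t \<in> closed_segment a b \<Longrightarrow> (h has_real_derivative h' t) (at t)"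
  obtains \<xi> where "\<xi> \<in> closed_segment a b" "h b - h a = (b - a) * h' \<xi>"
proof (cases a b rule: linorder_cases)
  case less
  then obtain z where "a < z" "z < b" "h b - h a = (b - a) * h' z"
    using assms MVT2[of a b h h'] by (force simp: closed_segment_eq_real_ivl)
  then show thesis
    using less by (intro that[of z]) (auto simp: closed_segment_eq_real_ivl)
next
  case equal
  then show thesis using that[of a] by simp
next
  case greater
  then obtain z where "b < z" "z < a" "h a - h b = (a - b) * h' z"
    using assms MVT2[of b a h h'] by (force simp: closed_segment_eq_real_ivl)
  then show thesis
    using greater by (intro that[of z]) (auto simp: closed_segment_eq_real_ivl algebra_simps)
qed

lemma mem_ball_of_closed_segment:
  fixes a b t :: real
  assumes "t \<in> closed_segment a b" "\<bar>a - z\<bar> < r" "\<bar>b - z\<bar> < r"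
  shows "\<bar>t - z\<bar> < r"
  using assms by (auto simp: closed_segment_eq_real_ivl split: if_splits)

text \<open>
  The derivative bound makes \<open>u x\<close> Lipschitz near \<open>\<theta>\<close> with a constant that does not depend on \<open>x\<close>; this
  uniformity is what upgrades separate to joint continuity.
\<close>
lemma tendsto_jointly_of_locally_bounded_derivative:
  fixes u u' :: "real \<Rightarrow> real \<Rightarrow> real"
  assumes cont: "((\<lambda>x. u x \<theta>) \<longlongrightarrow> u y \<theta>) (nhds y)"
    and deriv: "\<forall>\<^sub>F (x, t) in nhds (y, \<theta>).
      (u x has_real_derivative u' x t) (at t) \<and> \<bar>u' x t\<bar> \<le> M"
  shows "((\<lambda>(x, t). u x t) \<longlongrightarrow> u y \<theta>) (nhds (y, \<theta>))"
proof -
  obtain r where r: "r > 0" and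
    u': "\<And>x t. \<bar>x - y\<bar> < r \<Longrightarrow> \<bar>t - \<theta>\<bar> < r \<Longrightarrow>
           (u x has_real_derivative u' x t) (at t) \<and> \<bar>u' x t\<bar> \<le> M"
    using box_of_eventually_nhds[OF deriv] by auto
  have "\<bar>u x t - u x \<theta>\<bar> \<le> M * \<bar>t - \<theta>\<bar>" if "\<bar>x - y\<bar> < r" "\<bar>t - \<theta>\<bar> < r" for x t
  proof -
    have near: "\<bar>z - \<theta>\<bar> < r" if "z \<in> closed_segment \<theta> t" for z
      using mem_ball_of_closed_segment[OF that, of \<theta> r] r \<open>\<bar>t - \<theta>\<bar> < r\<close> by simp
    obtain \<xi> where "\<xi> \<in> closed_segment \<theta> t" "u x t - u x \<theta> = (t - \<theta>) * u' x \<xi>"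
      using mean_value_segment[of \<theta> t "u x" "u' x"] near u' \<open>\<bar>x - y\<bar> < r\<close> by blast
    moreover have "\<bar>u' x \<xi>\<bar> \<le> M"
      using near u' \<open>\<bar>x - y\<bar> < r\<close> calculation by blast
    ultimately show ?thesis
      using mult_left_mono[of "\<bar>u' x \<xi>\<bar>" M "\<bar>t - \<theta>\<bar>"] by (simp add: abs_mult mult.commute)
  qed
  then have bound: "\<forall>\<^sub>F z in nhds (y, \<theta>).
      norm (u (fst z) (snd z) - u (fst z) \<theta>) \<le> M * \<bar>snd z - \<theta>\<bar>"
    unfolding nhds_prod eventually_prod_filter using r
    by (intro exI[of _ "\<lambda>x. \<bar>x - y\<bar> < r"] exI[of _ "\<lambda>t. \<bar>t - \<theta>\<bar> < r"])
       (auto simp: eventually_nhds_metric dist_real_def)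
  have fst: "filterlim fst (nhds y) (nhds (y, \<theta>))" and snd: "(snd \<longlongrightarrow> \<theta>) (nhds (y, \<theta>))"
    by (simp_all add: nhds_prod filterlim_fst filterlim_snd)
  have "((\<lambda>z. M * \<bar>snd z - \<theta>\<bar>) \<longlongrightarrow> 0) (nhds (y, \<theta>))"
    by (rule tendsto_eq_intros snd refl | simp)+
  then have "((\<lambda>z. u (fst z) (snd z) - u (fst z) \<theta>) \<longlongrightarrow> 0) (nhds (y, \<theta>))"
    by (rule Lim_null_comparison[OF bound])
  from tendsto_add[OF this filterlim_compose[OF cont fst]]
  show ?thesis by (simp add: case_prod_beta')
qed

lemma isCont_imp_tendsto_nhds:
  assumes "isCont u z"
  shows "(u \<longlongrightarrow> u z) (nhds z)"
  using assms unfolding isCont_def tendsto_at_iff_tendsto_nhds .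

lemma C2_in_parameter_bounds:
  assumes "open Y" "open \<Theta>" "C2_in_parameter Y \<Theta> g" "y \<in> Y" "\<theta> \<in> \<Theta>"
  obtains M where "\<forall>\<^sub>F (x, t) in nhds (y, \<theta>). x \<in> Y \<and> t \<in> \<Theta> \<and>
    (g x has_real_derivative deriv (g x) t) (at t) \<and>
    (deriv (g x) has_real_derivative deriv (deriv (g x)) t) (at t) \<and>
    \<bar>deriv (deriv (g x)) t\<bar> \<le> M"
proof -
  let ?g'' = "\<lambda>z. deriv (deriv (g (fst z))) (snd z)"
  have op: "open (Y \<times> \<Theta>)" using assms by (simp add: open_Times)
  have "isCont ?g'' (y, \<theta>)"
    using assms op unfolding C2_in_parameter_def
    by (auto simp: continuous_on_eq_continuous_at case_prod_beta')
  then have "(?g'' \<longlongrightarrow> ?g'' (y, \<theta>)) (nhds (y, \<theta>))"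
    by (rule isCont_imp_tendsto_nhds)
  then have "((\<lambda>z. \<bar>?g'' z\<bar>) \<longlongrightarrow> \<bar>?g'' (y, \<theta>)\<bar>) (nhds (y, \<theta>))"
    by (rule tendsto_rabs)
  then have "\<forall>\<^sub>F z in nhds (y, \<theta>). \<bar>?g'' z\<bar> < \<bar>?g'' (y, \<theta>)\<bar> + 1"
    by (rule order_tendstoD) simp
  moreover have "\<forall>\<^sub>F z in nhds (y, \<theta>). z \<in> Y \<times> \<Theta>"
    using op assms by (intro eventually_nhds_in_open) auto
  ultimately have "\<forall>\<^sub>F (x, t) in nhds (y, \<theta>). x \<in> Y \<and> t \<in> \<Theta> \<and>
    (g x has_real_derivative deriv (g x) t) (at t) \<and>
    (deriv (g x) has_real_derivative deriv (deriv (g x)) t) (at t) \<and>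
    \<bar>deriv (deriv (g x)) t\<bar> \<le> \<bar>?g'' (y, \<theta>)\<bar> + 1"
    by eventually_elim
      (use assms in \<open>auto simp: C2_in_parameter_def DERIV_deriv_iff_real_differentiable\<close>)
  then show thesis by (rule that)
qed

text \<open>
  A pointwise limit of continuous functions need not be continuous, so continuity of \<open>g\<close> in \<open>x\<close> does
  not by itself pass to the parameter derivative. With second derivatives bounded by \<open>M\<close>, however, the
  difference quotient with increment \<open>h\<close> is within \<open>M * h\<close> of the derivative for all \<open>x\<close> near \<open>y\<close> at
  once, and the limit is uniform.
\<close>
lemma tendsto_parameter_derivative:
  assumes "open Y" "open \<Theta>" "C2_in_parameter Y \<Theta> g" "y \<in> Y" "\<theta> \<in> \<Theta>"
    and cont: "\<And>t. t \<in> \<Theta> \<Longrightarrow> continuous_on Y (\<lambda>x. g x t)"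
  shows "((\<lambda>x. deriv (g x) \<theta>) \<longlongrightarrow> deriv (g y) \<theta>) (nhds y)"
proof (rule tendstoI)
  fix e :: real assume e: "e > 0"
  obtain M where M: "\<forall>\<^sub>F (x, t) in nhds (y, \<theta>). x \<in> Y \<and> t \<in> \<Theta> \<and>
      (g x has_real_derivative deriv (g x) t) (at t) \<and>
      (deriv (g x) has_real_derivative deriv (deriv (g x)) t) (at t) \<and>
      \<bar>deriv (deriv (g x)) t\<bar> \<le> M"
    using C2_in_parameter_bounds[OF assms(1-5)] .
  then obtain r where r: "r > 0" and
    box: "\<And>x t. \<bar>x - y\<bar> < r \<Longrightarrow> \<bar>t - \<theta>\<bar> < r \<Longrightarrow> x \<in> Y \<and> t \<in> \<Theta> \<and>
      (g x has_real_derivative deriv (g x) t) (at t) \<and>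
      (deriv (g x) has_real_derivative deriv (deriv (g x)) t) (at t) \<and>
      \<bar>deriv (deriv (g x)) t\<bar> \<le> M"
    using box_of_eventually_nhds[OF M] by auto
  have M0: "M \<ge> 0"
    using box[of y \<theta>] r by (auto intro: order_trans[OF abs_ge_zero])
  define h where "h = min (r / 2) (e / (4 * (M + 1)))"
  have h: "h > 0" "h < r" using r e M0 by (auto simp: h_def)
  have "M * h \<le> (M + 1) * (e / (4 * (M + 1)))"
    using M0 h by (intro mult_mono) (auto simp: h_def)
  also have "\<dots> = e / 4"
    using nonzero_mult_div_cancel_left[of "M + 1" "e / 4"] M0 by (simp add: field_simps)
  finally have Mh: "M * h \<le> e / 4" .
  define quot where "quot x = (g x (\<theta> + h) - g x \<theta>) / h" for x
  have quot: "\<bar>quot x - deriv (g x) \<theta>\<bar> \<le> e / 4" if x: "\<bar>x - y\<bar> < r" for x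
  proof -
    have near: "\<bar>t - \<theta>\<bar> < r" if "t \<in> closed_segment \<theta> (\<theta> + h)" for t
      using that h by (auto simp: closed_segment_eq_real_ivl)
    obtain \<xi> where \<xi>: "\<xi> \<in> closed_segment \<theta> (\<theta> + h)"
      and "g x (\<theta> + h) - g x \<theta> = (\<theta> + h - \<theta>) * deriv (g x) \<xi>"
      using mean_value_segment[of \<theta> "\<theta> + h" "g x" "deriv (g x)"] near box x by blast
    then have q: "quot x = deriv (g x) \<xi>" using h by (simp add: quot_def)
    have sub: "t \<in> closed_segment \<theta> (\<theta> + h)" if "t \<in> closed_segment \<theta> \<xi>" for t
      using that \<xi> h by (auto simp: closed_segment_eq_real_ivl split: if_splits)
    obtain \<zeta> where "\<zeta> \<in> closed_segment \<theta> \<xi>"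
      and "deriv (g x) \<xi> - deriv (g x) \<theta> = (\<xi> - \<theta>) * deriv (deriv (g x)) \<zeta>"
      using mean_value_segment[of \<theta> \<xi> "deriv (g x)" "deriv (deriv (g x))"] near box x sub by blast
    moreover from this have "\<bar>deriv (deriv (g x)) \<zeta>\<bar> \<le> M" using near sub box x by blast
    moreover have "\<bar>\<xi> - \<theta>\<bar> \<le> h" using \<xi> h by (auto simp: closed_segment_eq_real_ivl)
    ultimately have "\<bar>quot x - deriv (g x) \<theta>\<bar> \<le> h * M"
      using q h by (simp add: abs_mult mult_mono)
    with Mh show ?thesis by (simp add: mult.commute)
  qed
  have "isCont (\<lambda>x. g x t) y" if "t \<in> \<Theta>" for t
    using cont[OF that] assms by (simp add: continuous_on_eq_continuous_at)
  then have lim: "((\<lambda>x. g x t) \<longlongrightarrow> g y t) (nhds y)" if "t \<in> \<Theta>" for t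
    using isCont_imp_tendsto_nhds that by blast
  have "\<theta> + h \<in> \<Theta>" using box[of y "\<theta> + h"] h by simp
  then have "(quot \<longlongrightarrow> quot y) (nhds y)"
    unfolding quot_def using lim assms h by (intro tendsto_intros) auto
  then have "\<forall>\<^sub>F x in nhds y. dist (quot x) (quot y) < e / 4"
    using e by (intro tendstoD) auto
  moreover have "\<forall>\<^sub>F x in nhds y. \<bar>x - y\<bar> < r"
    using r by (auto simp: eventually_nhds_metric dist_real_def)
  ultimately show "\<forall>\<^sub>F x in nhds y. dist (deriv (g x) \<theta>) (deriv (g y) \<theta>) < e"
  proof eventually_elim
    case (elim x)
    have "\<bar>quot y - deriv (g y) \<theta>\<bar> \<le> e / 4" using quot[of y] r by simp
    then show ?case using quot[OF elim(2)] elim(1) e unfolding dist_real_def by linarith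
  qed
qed

text \<open>
  Joint continuity descends from the second derivative to the first, and from the first to the
  function itself: at each level the derivative above supplies the local bound.
\<close>
lemma C2_in_parameter_tendsto_jointly:
  assumes "open Y" "open \<Theta>" "C2_in_parameter Y \<Theta> g" "y \<in> Y" "\<theta> \<in> \<Theta>"
    and cont: "\<And>t. t \<in> \<Theta> \<Longrightarrow> continuous_on Y (\<lambda>x. g x t)"
  shows "((\<lambda>(x, t). deriv (g x) t) \<longlongrightarrow> deriv (g y) \<theta>) (nhds (y, \<theta>))"
    and "((\<lambda>(x, t). g x t) \<longlongrightarrow> g y \<theta>) (nhds (y, \<theta>))"
proof -
  obtain M where M: "\<forall>\<^sub>F (x, t) in nhds (y, \<theta>). x \<in> Y \<and> t \<in> \<Theta> \<and>
      (g x has_real_derivative deriv (g x) t) (at t) \<and>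
      (deriv (g x) has_real_derivative deriv (deriv (g x)) t) (at t) \<and>
      \<bar>deriv (deriv (g x)) t\<bar> \<le> M"
    using C2_in_parameter_bounds[OF assms(1-5)] .
  show g': "((\<lambda>(x, t). deriv (g x) t) \<longlongrightarrow> deriv (g y) \<theta>) (nhds (y, \<theta>))"
    by (rule tendsto_jointly_of_locally_bounded_derivative
        [where u' = "\<lambda>x. deriv (deriv (g x))" and M = M])
       (use tendsto_parameter_derivative[OF assms] M in \<open>auto elim: eventually_mono\<close>)
  have "\<forall>\<^sub>F z in nhds (y, \<theta>). \<bar>(\<lambda>(x, t). deriv (g x) t) z\<bar> < \<bar>deriv (g y) \<theta>\<bar> + 1"
    by (rule order_tendstoD[OF tendsto_rabs[OF g']]) simp
  with M have "\<forall>\<^sub>F (x, t) in nhds (y, \<theta>).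
      (g x has_real_derivative deriv (g x) t) (at t) \<and> \<bar>deriv (g x) t\<bar> \<le> \<bar>deriv (g y) \<theta>\<bar> + 1"
    by eventually_elim auto
  moreover have "((\<lambda>x. g x \<theta>) \<longlongrightarrow> g y \<theta>) (nhds y)"
    using cont[of \<theta>] assms
    by (intro isCont_imp_tendsto_nhds) (simp add: continuous_on_eq_continuous_at)
  ultimately show "((\<lambda>(x, t). g x t) \<longlongrightarrow> g y \<theta>) (nhds (y, \<theta>))"
    by (intro tendsto_jointly_of_locally_bounded_derivative)
qed

section \<open>The censored log score\<close>

lemma continuous_on_xlnx: "continuous_on {0..} (\<lambda>z::real. z * ln z)"
  unfolding continuous_on_eq_continuous_within
proof
  fix z :: real assume "z \<in> {0..}"
  show "continuous (at z within {0..}) (\<lambda>z. z * ln z)"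
  proof (cases "z = 0")
    case True
    have "((\<lambda>z::real. z * ln z) \<longlongrightarrow> 0) (at_right 0)"
      by real_asymp
    then show ?thesis
      using True by (simp add: continuous_within at_within_Ici_at_right)
  next
    case False
    with \<open>z \<in> {0..}\<close> show ?thesis
      by (intro continuous_intros) auto
  qed
qed

lemma density_on_Diff_mass:
  fixes p :: "real \<Rightarrow> real"
  assumes "density_on Y p" "B \<in> sets lborel" "Y \<in> sets lborel" "B \<subseteq> Y"
  shows "(LBINT x:Y - B. p x) = 1 - (LBINT x:B. p x)" "0 \<le> (LBINT x:Y - B. p x)"
proof -
  have "set_integrable lborel Y p" "(LBINT x:Y. p x) = 1" "\<And>x. x \<in> Y \<Longrightarrow> 0 \<le> p x"
    using assms(1) by (auto simp: density_on_def)
  moreover have "Y = B \<union> (Y - B)" using assms(4) by auto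
  moreover have "set_integrable lborel B p" "set_integrable lborel (Y - B) p"
    using assms calculation by (auto intro: set_integrable_subset)
  ultimately show "(LBINT x:Y - B. p x) = 1 - (LBINT x:B. p x)"
    using set_integral_Un[of B "Y - B" lborel p] by auto
  show "0 \<le> (LBINT x:Y - B. p x)"
    using \<open>\<And>x. x \<in> Y \<Longrightarrow> 0 \<le> p x\<close>
    by (auto simp: set_lebesgue_integral_def indicator_def intro!: Bochner_Integration.integral_nonneg)
qed

definition censored_log_score :: "real set \<Rightarrow> real set \<Rightarrow> (real \<Rightarrow> real) \<Rightarrow> (real \<Rightarrow> real) \<Rightarrow> real" where
  "censored_log_score Y B p q =
     (LBINT x:B. p x * ln (q x)) + (LBINT x:Y - B. p x) * ln (1 - (LBINT x:B. q x))"

text \<open>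
  The entropy part, the same for every \<open>q\<close>, must be finite for the split to be legitimate; on \<open>[a, b]\<close>
  this follows from the continuity of \<open>z ln z\<close> up to \<open>z = 0\<close>, where the convention \<open>ln 0 = 0\<close> gives the
  right value.
\<close>
lemma CKL_split:
  fixes p q :: "real \<Rightarrow> real"
  assumes "open Y" "{a..b} \<subseteq> Y" and p: "density_on Y p" and q: "density_on Y q"
    and cp: "continuous_on {a..b} p" and cq: "continuous_on {a..b} q"
    and qpos: "\<And>x. x \<in> {a..b} \<Longrightarrow> 0 < q x"
    and mass: "(LBINT x:{a..b}. q x) < 1"
  shows "CKL Y {a..b} p q =
    (LBINT x:{a..b}. p x * ln (p x)) + (LBINT x:Y - {a..b}. p x) * ln (LBINT x:Y - {a..b}. p x)
    - censored_log_score Y {a..b} p q"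
proof -
  have Y: "Y \<in> sets lborel" using \<open>open Y\<close> by simp
  have pnn: "0 \<le> p x" if "x \<in> {a..b}" for x
    using p that assms(2) by (auto simp: density_on_def)
  have "continuous_on {a..b} (\<lambda>x. p x * ln (p x))"
    using pnn by (intro continuous_on_compose2[OF continuous_on_xlnx cp]) auto
  then have i1: "set_integrable lborel {a..b} (\<lambda>x. p x * ln (p x))"
    by (rule borel_integrable_atLeastAtMost')
  have "continuous_on {a..b} (\<lambda>x. p x * ln (q x))"
    using cp cq qpos by (intro continuous_intros) force+
  then have i2: "set_integrable lborel {a..b} (\<lambda>x. p x * ln (q x))"
    by (rule borel_integrable_atLeastAtMost')
  have "ln (p x / q x) * p x = p x * ln (p x) - p x * ln (q x)" if "x \<in> {a..b}" for x
    using pnn[OF that] qpos[OF that] by (cases "p x = 0") (simp_all add: ln_div algebra_simps)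
  then have "(LBINT x:{a..b}. ln (p x / q x) * p x)
      = (LBINT x:{a..b}. p x * ln (p x) - p x * ln (q x))"
    by (intro set_lebesgue_integral_cong) auto
  also have "\<dots> = (LBINT x:{a..b}. p x * ln (p x)) - (LBINT x:{a..b}. p x * ln (q x))"
    using i1 i2 by (rule set_integral_diff)
  finally have inner: "(LBINT x:{a..b}. ln (p x / q x) * p x) =
    (LBINT x:{a..b}. p x * ln (p x)) - (LBINT x:{a..b}. p x * ln (q x))" .
  let ?P = "LBINT x:Y - {a..b}. p x"
  have Q: "(LBINT x:Y - {a..b}. q x) = 1 - (LBINT x:{a..b}. q x)"
    using density_on_Diff_mass[OF q _ Y] assms(2) by simp
  have "?P \<ge> 0" using density_on_Diff_mass[OF p _ Y] assms(2) by simp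
  then have "ln (?P / (1 - (LBINT x:{a..b}. q x))) * ?P
      = ?P * ln ?P - ?P * ln (1 - (LBINT x:{a..b}. q x))"
    using mass by (cases "?P = 0") (simp_all add: ln_div algebra_simps)
  then show ?thesis unfolding CKL_def censored_log_score_def using inner Q by simp
qed

lemma set_integral_interval_bounds:
  fixes h :: "real \<Rightarrow> real"
  assumes "continuous_on {a..b} h" "a \<le> b"
  shows "(\<And>x. x \<in> {a..b} \<Longrightarrow> h x \<le> C) \<Longrightarrow> (LBINT x:{a..b}. h x) \<le> (b - a) * C"
    and "(\<And>x. x \<in> {a..b} \<Longrightarrow> C \<le> h x) \<Longrightarrow> (b - a) * C \<le> (LBINT x:{a..b}. h x)"
proof -
  have int: "set_integrable lborel {a..b} h" "set_integrable lborel {a..b} (\<lambda>_. C)"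
    using assms by (auto intro!: borel_integrable_atLeastAtMost' continuous_intros)
  have C: "(LBINT x:{a..b}. C) = (b - a) * C"
    using assms by (simp add: set_lebesgue_integral_def)
  show "(\<And>x. x \<in> {a..b} \<Longrightarrow> h x \<le> C) \<Longrightarrow> (LBINT x:{a..b}. h x) \<le> (b - a) * C"
    using set_integral_mono[OF int] C by metis
  show "(\<And>x. x \<in> {a..b} \<Longrightarrow> C \<le> h x) \<Longrightarrow> (b - a) * C \<le> (LBINT x:{a..b}. h x)"
    using set_integral_mono[OF int(2,1)] C by metis
qed

text \<open>
  Linearising the logarithm of the outside mass at an intermediate value \<open>\<eta>\<close> brings the contribution
  from outside the interval under the integral over the interval. The factor \<open>1 / \<eta>\<close> is common to all
  \<open>x\<close>, so the integrand can afterwards be studied for each \<open>x\<close> separately.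
\<close>
lemma censored_log_score_diff:
  fixes p q q' :: "real \<Rightarrow> real"
  assumes cp: "continuous_on {a..b} p"
    and cq: "continuous_on {a..b} q" "continuous_on {a..b} q'"
    and pos: "\<And>x. x \<in> {a..b} \<Longrightarrow> 0 < q x" "\<And>x. x \<in> {a..b} \<Longrightarrow> 0 < q' x"
    and mass: "(LBINT x:{a..b}. q x) < 1" "(LBINT x:{a..b}. q' x) < 1"
  obtains \<eta> where "\<eta> \<in> closed_segment (1 - (LBINT x:{a..b}. q x)) (1 - (LBINT x:{a..b}. q' x))"
    and "censored_log_score Y {a..b} p q' - censored_log_score Y {a..b} p q =
      (LBINT x:{a..b}. p x * (ln (q' x) - ln (q x))
         - (LBINT x:Y - {a..b}. p x) / \<eta> * (q' x - q x))"
proof -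
  let ?Q = "LBINT x:{a..b}. q x" and ?Q' = "LBINT x:{a..b}. q' x"
  let ?P = "LBINT x:Y - {a..b}. p x"
  have pos_seg: "0 < t" if "t \<in> closed_segment (1 - ?Q) (1 - ?Q')" for t
    using that mass by (auto simp: closed_segment_eq_real_ivl split: if_splits)
  obtain \<eta> where \<eta>: "\<eta> \<in> closed_segment (1 - ?Q) (1 - ?Q')"
    and ln: "ln (1 - ?Q') - ln (1 - ?Q) = (1 - ?Q' - (1 - ?Q)) * (1 / \<eta>)"
    using mean_value_segment[of "1 - ?Q" "1 - ?Q'" ln "\<lambda>t. 1 / t"] pos_seg DERIV_ln_divide by blast
  have cln: "continuous_on {a..b} (\<lambda>x. p x * ln (q x))" "continuous_on {a..b} (\<lambda>x. p x * ln (q' x))"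
    using cp cq pos by (intro continuous_intros; force)+
  note int = cln[THEN borel_integrable_atLeastAtMost'] cq[THEN borel_integrable_atLeastAtMost']
  have "(LBINT x:{a..b}. p x * (ln (q' x) - ln (q x)) - ?P / \<eta> * (q' x - q x))
      = (LBINT x:{a..b}. (p x * ln (q' x) - p x * ln (q x)) - ?P / \<eta> * (q' x - q x))"
    by (simp add: right_diff_distrib)
  also have "\<dots> = ((LBINT x:{a..b}. p x * ln (q' x)) - (LBINT x:{a..b}. p x * ln (q x)))
      - ?P / \<eta> * (?Q' - ?Q)"
    using int by (simp add: set_integral_diff set_integrable_mult_right)
  also have "\<dots> = censored_log_score Y {a..b} p q' - censored_log_score Y {a..b} p q"
    using arg_cong[OF ln, of "\<lambda>z. ?P * z"] unfolding censored_log_score_def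
    by (simp add: algebra_simps diff_divide_distrib)
  finally show thesis using that[OF \<eta>] by simp
qed

section \<open>The sign of the censored divergence change\<close>

theorem theoremI1:
  fixes Y \<Theta> :: "real set"
    and f :: "real \<Rightarrow> real \<Rightarrow> real"
    and P :: "(real \<Rightarrow> real) set"
    and y \<theta> :: real
    and p :: "real \<Rightarrow> real"
  assumes "open Y" and "convex Y" and "open \<Theta>" and "convex \<Theta>"
    and "density_family Y \<Theta> f"
    and "C2_in_parameter Y \<Theta> (\<lambda>x \<theta>. ln (f x \<theta>))"
    and "\<And>\<theta>. \<theta> \<in> \<Theta> \<Longrightarrow> \<exists>L. L-lipschitz_on Y (\<lambda>x. ln (f x \<theta>))"
    and "\<And>p. p \<in> P \<Longrightarrow> density_on Y p"
    and "\<And>p. p \<in> P \<Longrightarrow> \<exists>L. L-lipschitz_on Y p"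
    and "\<And>p. p \<in> P \<Longrightarrow> bounded (p ` Y)"
    and "y \<in> Y" and "\<theta> \<in> \<Theta>" and "p \<in> P"
    and "(p y - f y \<theta>) * score f y \<theta> \<noteq> 0"
  shows "\<exists>\<kappa>>0. \<exists>\<delta>>0. \<forall>\<phi> \<in> Y \<times> \<Theta> \<rightarrow> \<Theta>.
           update_step \<phi> y \<theta> \<noteq> 0 \<and> \<bar>update_step \<phi> y \<theta>\<bar> < \<kappa> \<longrightarrow>
           (CKL_change Y f \<delta> \<phi> y \<theta> p < 0 \<longleftrightarrow>
            score f y \<theta> * update_step \<phi> y \<theta> * (p y - f y \<theta>) > 0)"
proof -
  define g where "g x t = ln (f x t)" for x t
  define A where "A = score f y \<theta> * (p y - f y \<theta>)"
  have A0: "A \<noteq> 0" using assms by (auto simp: A_def)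
  have C2: "C2_in_parameter Y \<Theta> g"
    using assms(6) by (simp add: g_def[abs_def])
  have fpos: "0 < f x t" if "x \<in> Y" "t \<in> \<Theta>" for x t
    using assms(5) that by (auto simp: density_family_def)
  have dens: "density_on Y (\<lambda>x. f x t)" if "t \<in> \<Theta>" for t
    using assms(5) that by (auto simp: density_family_def)
  have f_exp: "f x t = exp (g x t)" if "x \<in> Y" "t \<in> \<Theta>" for x t
    using fpos[OF that] by (simp add: g_def)
  have contg: "continuous_on Y (\<lambda>x. g x t)" if "t \<in> \<Theta>" for t
    using assms(7)[OF that] lipschitz_on_continuous_on unfolding g_def by blast
  have contf: "continuous_on Y (\<lambda>x. f x t)" if "t \<in> \<Theta>" for t
    using continuous_on_exp[OF contg[OF that]] f_exp that
    by (simp cong: continuous_on_cong)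
  have contp: "continuous_on Y p"
    using assms lipschitz_on_continuous_on by blast
  have densp: "density_on Y p" using assms by blast
  have pnn: "0 \<le> p x" if "x \<in> Y" for x using densp that by (simp add: density_on_def)
  have s_eq: "score f y \<theta> = deriv (g y) \<theta>" by (simp add: score_def g_def[abs_def])

  note joint = C2_in_parameter_tendsto_jointly[OF \<open>open Y\<close> \<open>open \<Theta>\<close> C2 \<open>y \<in> Y\<close> \<open>\<theta> \<in> \<Theta>\<close> contg]
  have lim_s: "((\<lambda>z. deriv (g (fst z)) (snd z)) \<longlongrightarrow> score f y \<theta>) (nhds (y, \<theta>))"
    and lim_g: "((\<lambda>z. g (fst z) (snd z)) \<longlongrightarrow> g y \<theta>) (nhds (y, \<theta>))"
    using joint by (simp_all add: case_prod_beta' s_eq)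
  have lim_f: "((\<lambda>z. exp (g (fst z) (snd z))) \<longlongrightarrow> f y \<theta>) (nhds (y, \<theta>))"
    using tendsto_exp[OF lim_g] f_exp[OF \<open>y \<in> Y\<close> \<open>\<theta> \<in> \<Theta>\<close>] by simp
  have fst_lim: "filterlim fst (nhds y) (nhds (y, \<theta>))"
    by (simp add: nhds_prod filterlim_fst)
  have "isCont p y"
    using contp assms by (simp add: continuous_on_eq_continuous_at)
  then have lim_p: "((\<lambda>z. p (fst z)) \<longlongrightarrow> p y) (nhds (y, \<theta>))"
    by (intro filterlim_compose[OF isCont_imp_tendsto_nhds fst_lim])

  \<comment> \<open>Parameter derivative of \<open>p x * ln (f x t) - c * f x t\<close>; its value at \<open>(y, \<theta>)\<close> for \<open>c = 1\<close> is \<open>A\<close>.\<close>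
  define slope where "slope x t c = deriv (g x) t * (p x - c * exp (g x t))" for x t c
  let ?F = "nhds (y, \<theta>) \<times>\<^sub>F nhds (1::real)"
  note lims = lim_s lim_f lim_p
  note lims' = lims[THEN filterlim_compose, OF filterlim_fst[where G = "nhds (1::real)"]]
  have "((\<lambda>w. A * slope (fst (fst w)) (snd (fst w)) (snd w)) \<longlongrightarrow>
      A * (score f y \<theta> * (p y - 1 * f y \<theta>))) ?F"
    unfolding slope_def by (intro tendsto_intros lims' filterlim_snd)
  then have "((\<lambda>w. A * slope (fst (fst w)) (snd (fst w)) (snd w)) \<longlongrightarrow> A * A) ?F"
    by (simp add: A_def)
  moreover have "A * A / 2 < A * A" using not_real_square_gt_zero[of A] A0 by linarith
  ultimately have "\<forall>\<^sub>F w in ?F. A * A / 2 < A * slope (fst (fst w)) (snd (fst w)) (snd w)"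
    by (rule order_tendstoD)
  then obtain S T where S: "eventually S (nhds (y, \<theta>))" and T: "eventually T (nhds 1)"
    and slope_ST: "\<And>x t c. S (x, t) \<Longrightarrow> T c \<Longrightarrow> A * A / 2 < A * slope x t c"
    unfolding eventually_prod_filter by auto
  \<comment> \<open>A local bound of both densities, which controls the mass inside a small interval.\<close>
  define C where "C = f y \<theta> + p y + 1"
  have C: "C > 0" "f y \<theta> < C" "p y < C"
    using fpos[OF \<open>y \<in> Y\<close> \<open>\<theta> \<in> \<Theta>\<close>] pnn[OF \<open>y \<in> Y\<close>] by (auto simp: C_def)
  obtain M where M: "\<forall>\<^sub>F (x, t) in nhds (y, \<theta>). x \<in> Y \<and> t \<in> \<Theta> \<and>
      (g x has_real_derivative deriv (g x) t) (at t) \<and>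
      (deriv (g x) has_real_derivative deriv (deriv (g x)) t) (at t) \<and>
      \<bar>deriv (deriv (g x)) t\<bar> \<le> M"
    using C2_in_parameter_bounds[OF \<open>open Y\<close> \<open>open \<Theta>\<close> C2 \<open>y \<in> Y\<close> \<open>\<theta> \<in> \<Theta>\<close>] .
  from S M order_tendstoD(2)[OF lim_f C(2)] order_tendstoD(2)[OF lim_p C(3)]
  have "\<forall>\<^sub>F z in nhds (y, \<theta>). S z \<and> fst z \<in> Y \<and> snd z \<in> \<Theta> \<and>
      (g (fst z) has_real_derivative deriv (g (fst z)) (snd z)) (at (snd z)) \<and>
      exp (g (fst z) (snd z)) < C \<and> p (fst z) < C"
    by eventually_elim auto
  note box_of_eventually_nhds[OF this, unfolded fst_conv snd_conv]
  then obtain r where r: "r > 0" and box: "\<And>x t. \<bar>x - y\<bar> < r \<Longrightarrow> \<bar>t - \<theta>\<bar> < r \<Longrightarrow>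
      S (x, t) \<and> x \<in> Y \<and> t \<in> \<Theta> \<and> (g x has_real_derivative deriv (g x) t) (at t) \<and>
      exp (g x t) < C \<and> p x < C"
    by blast
  obtain e where e: "e > 0" and T_near: "\<And>c. \<bar>c - 1\<bar> < e \<Longrightarrow> T c"
    using T by (auto simp: eventually_nhds_metric dist_real_def)
  \<comment> \<open>If both outside masses are at least \<open>1 - w\<close>, their quotient is within \<open>2 * w\<close> of \<open>1\<close>.\<close>
  define w where "w = min (1 / 2) (e / 4)"
  have w: "w > 0" "w \<le> 1 / 2" "w \<le> e / 4" using e by (auto simp: w_def)
  have T_quot: "T (a / b)" if "a \<in> {1 - w..1}" "b \<in> {1 - w..1}" for a b
  proof (rule T_near)
    have b: "b \<ge> 1 / 2" using that w by simp
    have "\<bar>a / b - 1\<bar> = \<bar>a - b\<bar> / b" using b by (simp add: field_simps abs_if)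
    also have "\<dots> \<le> w / (1 / 2)" using that b w by (intro frac_le) auto
    also have "\<dots> < e" using w e by simp
    finally show "\<bar>a / b - 1\<bar> < e" .
  qed
  \<comment> \<open>The interval has length \<open>2 * \<delta>\<close>, so no density below \<open>C\<close> puts mass above \<open>w\<close> on it.\<close>
  define \<delta> where "\<delta> = min (r / 2) (w / (2 * C))"
  have \<delta>: "\<delta> > 0" "\<delta> < r" using r w C by (auto simp: \<delta>_def)
  have "2 * \<delta> * C \<le> 2 * (w / (2 * C)) * C"
    using C by (intro mult_right_mono) (auto simp: \<delta>_def)
  then have \<delta>C: "2 * \<delta> * C \<le> w" using C by simp

  let ?B = "{y - \<delta>..y + \<delta>}"
  have near: "\<bar>x - y\<bar> < r" if "x \<in> ?B" for x using that \<delta> by auto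
  have BY: "?B \<subseteq> Y" using near box[of _ \<theta>] r by auto
  have ball: "obs_ball Y \<delta> y = ?B" using BY by (auto simp: obs_ball_def)
  have mass: "(LBINT x:?B. h x) \<in> {0..w}"
    if "continuous_on Y h" "\<And>x. x \<in> ?B \<Longrightarrow> 0 \<le> h x" "\<And>x. x \<in> ?B \<Longrightarrow> h x \<le> C" for h
    using set_integral_interval_bounds[OF continuous_on_subset[OF that(1) BY], of C]
      set_integral_interval_bounds[OF continuous_on_subset[OF that(1) BY], of 0] \<delta> \<delta>C that by auto
  define Pc where "Pc = (LBINT x:Y - ?B. p x)"
  have "Pc = 1 - (LBINT x:?B. p x)"
    unfolding Pc_def using densp BY \<open>open Y\<close> by (intro density_on_Diff_mass) auto
  moreover have "(LBINT x:?B. p x) \<in> {0..w}"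
    using contp pnn BY near box[of _ \<theta>] r by (intro mass) (auto intro: less_imp_le)
  ultimately have Pc: "Pc \<in> {1 - w..1}" by auto
  have mass_f: "(LBINT x:?B. f x t) \<in> {0..w}" if "t \<in> \<Theta>" "\<bar>t - \<theta>\<bar> < r" for t
    using contf that fpos BY near box[of _ t] f_exp
    by (intro mass) (auto intro!: less_imp_le simp: subset_iff)

  have "CKL_change Y f \<delta> \<phi> y \<theta> p < 0 \<longleftrightarrow>
      score f y \<theta> * update_step \<phi> y \<theta> * (p y - f y \<theta>) > 0"
    if \<phi>: "\<phi> \<in> Y \<times> \<Theta> \<rightarrow> \<Theta>" and step: "update_step \<phi> y \<theta> \<noteq> 0" "\<bar>update_step \<phi> y \<theta>\<bar> < r" for \<phi>
  proof -
    define \<theta>' where "\<theta>' = \<phi> (y, \<theta>)"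
    define \<Delta> where "\<Delta> = update_step \<phi> y \<theta>"
    have \<theta>': "\<theta>' \<in> \<Theta>" using \<phi> assms by (auto simp: \<theta>'_def Pi_iff)
    have \<Delta>: "\<theta>' = \<theta> + \<Delta>" "\<Delta> \<noteq> 0" "\<bar>\<theta>' - \<theta>\<bar> < r"
      using step by (auto simp: \<Delta>_def \<theta>'_def update_step_def)
    define D where "D = censored_log_score Y ?B p (\<lambda>x. f x \<theta>') - censored_log_score Y ?B p (\<lambda>x. f x \<theta>)"
    have lt1: "(LBINT x:?B. f x \<theta>) < 1" "(LBINT x:?B. f x \<theta>') < 1"
      using mass_f[OF \<open>\<theta> \<in> \<Theta>\<close>] mass_f[OF \<theta>' \<Delta>(3)] w r by auto
    have cB: "continuous_on ?B p" "continuous_on ?B (\<lambda>x. f x \<theta>)" "continuous_on ?B (\<lambda>x. f x \<theta>')"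
      using contp contf \<open>\<theta> \<in> \<Theta>\<close> \<theta>' BY by (auto intro: continuous_on_subset)
    have pB: "0 < f x \<theta>" "0 < f x \<theta>'" if "x \<in> ?B" for x
      using that BY fpos \<open>\<theta> \<in> \<Theta>\<close> \<theta>' by auto
    have change: "CKL_change Y f \<delta> \<phi> y \<theta> p = - D"
      unfolding CKL_change_def ball D_def \<theta>'_def[symmetric]
      using CKL_split[OF \<open>open Y\<close> BY densp dens[OF \<open>\<theta> \<in> \<Theta>\<close>] cB(1,2) pB(1) lt1(1)]
        CKL_split[OF \<open>open Y\<close> BY densp dens[OF \<theta>'] cB(1,3) pB(2) lt1(2)] by simp
    obtain \<eta> where \<eta>: "\<eta> \<in> closed_segment (1 - (LBINT x:?B. f x \<theta>)) (1 - (LBINT x:?B. f x \<theta>'))"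
      and D: "D = (LBINT x:?B. p x * (ln (f x \<theta>') - ln (f x \<theta>)) - Pc / \<eta> * (f x \<theta>' - f x \<theta>))"
      using censored_log_score_diff[OF cB pB lt1] unfolding D_def Pc_def by blast
    define c where "c = Pc / \<eta>"
    have "\<eta> \<in> {1 - w..1}"
      using \<eta> mass_f[OF \<open>\<theta> \<in> \<Theta>\<close>] mass_f[OF \<theta>' \<Delta>(3)] r
      by (auto simp: closed_segment_eq_real_ivl split: if_splits)
    then have Tc: "T c" unfolding c_def using T_quot Pc by blast
    define v where "v x = p x * (ln (f x \<theta>') - ln (f x \<theta>)) - c * (f x \<theta>' - f x \<theta>)" for x
    \<comment> \<open>Dividing by the step and multiplying by \<open>A\<close> makes the bound independent of both signs.\<close>
    have v: "A * A / 2 \<le> A / \<Delta> * v x" if x: "x \<in> ?B" for x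
    proof -
      define h where "h t = p x * g x t - c * exp (g x t)" for t
      have seg: "\<bar>t - \<theta>\<bar> < r" if "t \<in> closed_segment \<theta> \<theta>'" for t
        using mem_ball_of_closed_segment[OF that] r \<Delta> by simp
      have "(h has_real_derivative slope x t c) (at t)" if "t \<in> closed_segment \<theta> \<theta>'" for t
      proof -
        have g': "(g x has_real_derivative deriv (g x) t) (at t)"
          using box[OF near[OF x] seg[OF that]] by simp
        show ?thesis
          unfolding h_def slope_def
          using DERIV_diff[OF DERIV_cmult[OF g', of "p x"]
              DERIV_cmult[OF DERIV_chain2[OF DERIV_exp g'], of c]]
          by (simp add: algebra_simps)
      qed
      then obtain \<xi> where \<xi>: "\<xi> \<in> closed_segment \<theta> \<theta>'" "h \<theta>' - h \<theta> = (\<theta>' - \<theta>) * slope x \<xi> c"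
        using mean_value_segment[of \<theta> \<theta>' h "\<lambda>t. slope x t c"] by blast
      have "v x = h \<theta>' - h \<theta>"
        using f_exp \<open>\<theta> \<in> \<Theta>\<close> \<theta>' x BY by (auto simp: v_def h_def g_def[symmetric] algebra_simps)
      then have "A / \<Delta> * v x = A * slope x \<xi> c" using \<xi> \<Delta> by simp
      also have "\<dots> > A * A / 2"
        using slope_ST[OF _ Tc] box[OF near[OF x] seg[OF \<xi>(1)]] by simp
      finally show ?thesis by simp
    qed
    have "continuous_on ?B (\<lambda>x. A / \<Delta> * v x)"
      unfolding v_def using cB pB by (intro continuous_intros; force)
    from set_integral_interval_bounds(2)[OF this _ v]
    have "2 * \<delta> * (A * A / 2) \<le> (LBINT x:?B. A / \<Delta> * v x)" using \<delta> by simp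
    also have "\<dots> = A / \<Delta> * D" by (simp add: D v_def c_def)
    finally have "2 * \<delta> * (A * A / 2) \<le> A / \<Delta> * D" .
    moreover have "0 < A * A" using A0 not_real_square_gt_zero by blast
    then have "0 < 2 * \<delta> * (A * A / 2)"
      using mult_pos_pos[OF \<delta>(1)] by simp
    ultimately have "0 < A / \<Delta> * D" by linarith
    then have "D > 0 \<longleftrightarrow> A / \<Delta> > 0"
      by (metis zero_less_mult_pos zero_less_mult_pos2)
    also have "\<dots> \<longleftrightarrow> A * \<Delta> > 0"
      by (simp add: zero_less_mult_iff zero_less_divide_iff)
    finally have "D > 0 \<longleftrightarrow> A * \<Delta> > 0" .
    then show ?thesis unfolding change by (simp add: A_def \<Delta>_def mult_ac)
  qed
  then show ?thesis using r \<delta> by blast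
qed

end
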